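(* Let $G_1, G_2, \dots, G_n$ be any $n$ groups (finite or infinite, abelian or non-abelian). Then every normal subgroup of the product $\prod_{i=1}^{n} G_i$ is of the type $\prod_{i=1}^{n} N_i$ with $N_i$ a normal subgroup of $G_i$ for $i=1,2,\dots,n$, if and only if $G_1, G_2, \dots, G_n$ satisfy the NS-condition pairwise, i.e. for all $i \neq j$ the groups $G_i$ and $G_j$ satisfy the NS-condition.
   Context: Two groups $A$ and $B$ are said to have a subgroup in common if there exist non-trivial subgroups $A' \leq A$ and $B' \leq B$ such that $A' \cong B'$. Two groups $G$ and $G'$ are said to satisfy the NS-condition if for all normal subgroups $H$ of $G$ and $H'$ of $G'$, the centres $Z(G/H)$ and $Z(G'/H')$ of the quotient groups $G/H$ and $G'/H'$ have no subgroup in common. (Whether or not $H = G$ or $H' = G'$ is allowed makes no difference, since then the corresponding centre is trivial.) *)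

theory Defs
  imports "HOL-Algebra.Algebra"
begin

definition centre :: "('a, 'b) monoid_scheme \<Rightarrow> 'a set" where
  "centre G = {z \<in> carrier G. \<forall>g \<in> carrier G. z \<otimes>\<^bsub>G\<^esub> g = g \<otimes>\<^bsub>G\<^esub> z}"

definition centre_group :: "('a, 'b) monoid_scheme \<Rightarrow> ('a, 'b) monoid_scheme" where
  "centre_group G = G\<lparr>carrier := centre G\<rparr>"

lemma (in group) subgroup_centre: "subgroup (centre G) G"
proof (rule subgroupI)
  fix a assume a: "a \<in> centre G"
  then have ac: "a \<in> carrier G" and comm: "\<And>g. g \<in> carrier G \<Longrightarrow> a \<otimes> g = g \<otimes> a"
    by (auto simp: centre_def)
  have "inv a \<otimes> g = g \<otimes> inv a" if g: "g \<in> carrier G" for g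
  proof -
    have "inv a \<otimes> g = inv a \<otimes> (g \<otimes> a) \<otimes> inv a"
      using ac g by (simp add: m_assoc)
    also have "\<dots> = inv a \<otimes> (a \<otimes> g) \<otimes> inv a"
      using comm[OF g] by simp
    also have "\<dots> = g \<otimes> inv a"
      using ac g by (simp flip: m_assoc)
    finally show ?thesis .
  qed
  then show "inv a \<in> centre G" using ac by (simp add: centre_def)
next
  fix a b assume "a \<in> centre G" "b \<in> centre G"
  then have ac: "a \<in> carrier G" and bc: "b \<in> carrier G"
    and ca: "\<And>g. g \<in> carrier G \<Longrightarrow> a \<otimes> g = g \<otimes> a"
    and cb: "\<And>g. g \<in> carrier G \<Longrightarrow> b \<otimes> g = g \<otimes> b"
    by (auto simp: centre_def)
  have "a \<otimes> b \<otimes> g = g \<otimes> (a \<otimes> b)" if g: "g \<in> carrier G" for g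
  proof -
    have "a \<otimes> b \<otimes> g = a \<otimes> (g \<otimes> b)"
      using ac bc g cb[OF g] by (simp add: m_assoc)
    also have "\<dots> = g \<otimes> a \<otimes> b"
      using ac bc g ca[OF g] by (simp flip: m_assoc)
    finally show ?thesis
      using ac bc g by (simp add: m_assoc)
  qed
  then show "a \<otimes> b \<in> centre G" using ac bc by (simp add: centre_def)
qed (auto simp: centre_def)

lemma (in group) group_centre_group: "group (centre_group G)"
  unfolding centre_group_def by (rule subgroup_imp_group[OF subgroup_centre])

definition subgroup_in_common :: "('a, 'c) monoid_scheme \<Rightarrow> ('b, 'd) monoid_scheme \<Rightarrow> bool" where
  "subgroup_in_common A B \<longleftrightarrow>
     (\<exists>A' B'. subgroup A' A \<and> A' \<noteq> {\<one>\<^bsub>A\<^esub>} \<and> subgroup B' B \<and> B' \<noteq> {\<one>\<^bsub>B\<^esub>} \<and>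
        A\<lparr>carrier := A'\<rparr> \<cong> B\<lparr>carrier := B'\<rparr>)"

definition NS_condition :: "('a, 'c) monoid_scheme \<Rightarrow> ('b, 'd) monoid_scheme \<Rightarrow> bool" where
  "NS_condition G G' \<longleftrightarrow>
     (\<forall>H H'. H \<lhd> G \<longrightarrow> H' \<lhd> G' \<longrightarrow>
        \<not> subgroup_in_common (centre_group (G Mod H)) (centre_group (G' Mod H')))"

end

theory Submission
  imports Defs
begin

text \<open>
  Write \<open>P\<close> for the product of the groups \<open>G i\<close>.

  If the condition fails for a pair \<open>i \<noteq> j\<close>, there is an isomorphism \<open>\<phi>\<close> from a non-trivial central
  subgroup \<open>A\<close> of \<open>G i / H\<close> onto a central subgroup of \<open>G j / H'\<close>. The elements \<open>f\<close> of \<open>P\<close> with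
  \<open>H f\<^sub>i \<in> A\<close> and \<open>\<phi> (H f\<^sub>i) = H' f\<^sub>j\<close> form a subgroup, the pullback of the graph of \<open>\<phi>\<close>. It is normal
  because conjugation moves neither coset, both being central. It is not a product of subsets
  of the factors: in such a product the coordinates vary independently, whereas here the coset of
  \<open>f\<^sub>i\<close> determines that of \<open>f\<^sub>j\<close>, and the latter takes more than one value.

  Conversely let \<open>K\<close> be normal in \<open>P\<close>, and let \<open>N\<^sub>i\<close> (the slice of \<open>K\<close> at \<open>i\<close>) consist of those \<open>x\<close> in
  \<open>G i\<close> for which the tuple with \<open>x\<close> in place \<open>i\<close> and \<open>1\<close> elsewhere lies in \<open>K\<close>. The slices are
  normal, and as the index set is finite the product of the \<open>N\<^sub>i\<close> is contained in \<open>K\<close>. For \<open>f\<close> in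
  \<open>K\<close> the commutator of \<open>f\<close> with a tuple supported in place \<open>i\<close> is again in \<open>K\<close> and supported in
  place \<open>i\<close>, so \<open>f\<^sub>i\<close> is central modulo \<open>N\<^sub>i\<close>. Suppose some element of \<open>K\<close> lies outside the product
  of the \<open>N\<^sub>i\<close>, and choose such an \<open>f\<close> for which the set \<open>S\<close> of places with \<open>f\<^sub>i \<notin> N\<^sub>i\<close> is as small
  as possible. One place is impossible by the definition of the slices, so \<open>S\<close> contains two places
  \<open>i \<noteq> j\<close>. Let \<open>L\<close> be the subgroup of those \<open>g \<in> K\<close> that lie in the slices outside \<open>S\<close>. By
  minimality of \<open>S\<close> an element of \<open>L\<close> that lies in its slice at one place of \<open>S\<close> does so at every
  place. Hence the projections of \<open>L\<close> to \<open>G i / N\<^sub>i\<close> and \<open>G j / N\<^sub>j\<close> have the same kernel, so their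
  images are isomorphic; they are central, and non-trivial because of \<open>f\<close>. This contradicts the
  condition for \<open>i\<close> and \<open>j\<close>. Taking a minimal \<open>S\<close> is what reduces any number of factors to two.

  The two directions are \<open>NS_condition_if_normal_subgroups_are_products\<close>, resting on
  \<open>normal_graph_of_central_hom\<close>, and \<open>eq_PiE_slice_if_NS\<close>, resting on
  \<open>coset_of_coordinate_central\<close> and \<open>iso_images_if_same_kernel\<close>.
\<close>

section \<open>Centres of quotients and common subgroups\<close>

lemma subgroup_centre_group_iff:
  assumes "group Q"
  shows "subgroup A (centre_group Q) \<longleftrightarrow> subgroup A Q \<and> A \<subseteq> centre Q"
proof -
  interpret group Q by fact
  show ?thesis
    unfolding centre_group_def
    using incl_subgroup[OF subgroup_centre] subgroup_incl[OF _ subgroup_centre]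
      subgroup.subset[of A "Q\<lparr>carrier := centre Q\<rparr>"]
    by auto
qed

lemma subgroup_in_common_centre_group_iff:
  assumes "group Q" "group R"
  shows "subgroup_in_common (centre_group Q) (centre_group R) \<longleftrightarrow>
    (\<exists>A B. subgroup A Q \<and> A \<subseteq> centre Q \<and> A \<noteq> {\<one>\<^bsub>Q\<^esub>} \<and>
           subgroup B R \<and> B \<subseteq> centre R \<and> B \<noteq> {\<one>\<^bsub>R\<^esub>} \<and>
           Q\<lparr>carrier := A\<rparr> \<cong> R\<lparr>carrier := B\<rparr>)"
  unfolding subgroup_in_common_def subgroup_centre_group_iff[OF assms(1)]
    subgroup_centre_group_iff[OF assms(2)]
  by (auto simp: centre_group_def)

lemma (in normal) rcos_in_centre_FactGroup:
  assumes x: "x \<in> carrier G"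
    and comm: "\<And>g. g \<in> carrier G \<Longrightarrow> (x \<otimes> g) \<otimes> inv (g \<otimes> x) \<in> H"
  shows "H #> x \<in> centre (G Mod H)"
proof -
  have "H #> (x \<otimes> g) = H #> (g \<otimes> x)" if g: "g \<in> carrier G" for g
  proof -
    have "x \<otimes> g = ((x \<otimes> g) \<otimes> inv (g \<otimes> x)) \<otimes> (g \<otimes> x)"
      using x g by (simp add: m_assoc)
    then have "x \<otimes> g \<in> H #> (g \<otimes> x)"
      using comm[OF g] by (auto simp: r_coset_def)
    then show ?thesis
      using repr_independence[OF _ _ subgroup_axioms, of "x \<otimes> g" "g \<otimes> x"] x g by simp
  qed
  then show ?thesis
    using x by (auto simp: centre_def carrier_FactGroup rcos_sum)
qed

lemma (in normal) rcos_eq_iff_mem: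
  "x \<in> carrier G \<Longrightarrow> H #> x = H \<longleftrightarrow> x \<in> H"
  using coset_join1 coset_join2 subgroup_axioms subset by blast

lemma (in group_hom) group_hom_on_subgroup:
  assumes "subgroup L G"
  shows "group_hom (G\<lparr>carrier := L\<rparr>) H h"
  using homh subgroup.subset[OF assms] G.subgroup_imp_group[OF assms] H.is_group
  unfolding group_hom_def group_hom_axioms_def hom_def by (simp add: Pi_iff subset_iff)

text \<open>
  Both images are isomorphic to the quotient of \<open>L\<close> by the common kernel. Applied to two coordinate
  projections of a subgroup of a product, this is the graph isomorphism of Goursat's lemma, obtained
  without naming the isomorphism.
\<close>
lemma iso_images_if_same_kernel:
  assumes "group_hom L A \<alpha>" "group_hom L B \<beta>"
    and "kernel L A \<alpha> = kernel L B \<beta>"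
  shows "A\<lparr>carrier := \<alpha> ` carrier L\<rparr> \<cong> B\<lparr>carrier := \<beta> ` carrier L\<rparr>"
proof -
  have first_iso: "L Mod kernel L C \<gamma> \<cong> C\<lparr>carrier := \<gamma> ` carrier L\<rparr>"
    if "group_hom L C \<gamma>" for C :: "('x, 'y) monoid_scheme" and \<gamma>
  proof -
    interpret \<gamma>: group_hom L C \<gamma> by fact
    have "group_hom L (C\<lparr>carrier := \<gamma> ` carrier L\<rparr>) \<gamma>"
      using \<gamma>.homh \<gamma>.H.subgroup_imp_group[OF \<gamma>.img_is_subgroup]
      by (auto simp: group_hom_def group_hom_axioms_def hom_def)
    from group_hom.FactGroup_iso[OF this] show ?thesis
      by (simp add: kernel_def)
  qed
  interpret \<alpha>: group_hom L A \<alpha> by fact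
  have "group (L Mod kernel L A \<alpha>)"
    by (rule normal.factorgroup_is_group[OF \<alpha>.normal_kernel])
  then have "A\<lparr>carrier := \<alpha> ` carrier L\<rparr> \<cong> L Mod kernel L A \<alpha>"
    using first_iso[OF assms(1)] group.iso_sym by blast
  also have "L Mod kernel L A \<alpha> \<cong> B\<lparr>carrier := \<beta> ` carrier L\<rparr>"
    using first_iso[OF assms(2)] assms(3) by simp
  finally (iso_trans) show ?thesis .
qed

section \<open>A normal subgroup that is not a product\<close>

text \<open>
  The set is the preimage under \<open>(\<alpha>, \<beta>)\<close> of the graph of \<open>\<phi>\<close>. Both coordinates of a point of that
  graph are central, so conjugation in \<open>P\<close> changes neither \<open>\<alpha> f\<close> nor \<open>\<beta> f\<close>.
\<close>
lemma normal_graph_of_central_hom: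
  assumes \<alpha>: "group_hom P Q \<alpha>" and \<beta>: "group_hom P R \<beta>"
    and A: "subgroup A Q" "A \<subseteq> centre Q"
    and \<phi>: "\<phi> \<in> hom (Q\<lparr>carrier := A\<rparr>) R" "\<phi> ` A \<subseteq> centre R"
  shows "{f \<in> carrier P. \<alpha> f \<in> A \<and> \<phi> (\<alpha> f) = \<beta> f} \<lhd> P" (is "?K \<lhd> P")
proof -
  interpret \<alpha>: group_hom P Q \<alpha> by fact
  interpret \<beta>: group_hom P R \<beta> by fact
  interpret A: subgroup A Q by fact
  interpret \<phi>: group_hom "Q\<lparr>carrier := A\<rparr>" R \<phi>
    using \<phi>(1) A(1) by (simp add: group_hom_def group_hom_axioms_def \<alpha>.H.subgroup_imp_group)
  have inv_A: "\<phi> (inv\<^bsub>Q\<^esub> a) = inv\<^bsub>R\<^esub> \<phi> a" if "a \<in> A" for a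
    using \<phi>.hom_inv[of a] that \<alpha>.H.m_inv_consistent[OF A(1) that] by simp
  have mult_A: "\<phi> (a \<otimes>\<^bsub>Q\<^esub> b) = \<phi> a \<otimes>\<^bsub>R\<^esub> \<phi> b" if "a \<in> A" "b \<in> A" for a b
    using \<phi>.hom_mult[of a b] that by simp
  have one_A: "\<phi> \<one>\<^bsub>Q\<^esub> = \<one>\<^bsub>R\<^esub>"
    using \<phi>.hom_one by simp
  have conj_central: "g \<otimes>\<^bsub>S\<^esub> z \<otimes>\<^bsub>S\<^esub> inv\<^bsub>S\<^esub> g = z"
    if "group S" "z \<in> centre S" "g \<in> carrier S" for S :: "('x, 'y) monoid_scheme" and g z
  proof -
    interpret S: group S by fact
    show ?thesis
      using that(2,3) S.inv_solve_right'[of z "g \<otimes>\<^bsub>S\<^esub> z" g] by (simp add: centre_def)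
  qed
  have "subgroup ?K P"
    by (rule \<alpha>.G.subgroupI)
      (auto simp: one_A inv_A mult_A intro!: exI[of _ "\<one>\<^bsub>P\<^esub>"])
  moreover have "x \<otimes>\<^bsub>P\<^esub> f \<otimes>\<^bsub>P\<^esub> inv\<^bsub>P\<^esub> x \<in> ?K" if x: "x \<in> carrier P" and f: "f \<in> ?K" for x f
  proof -
    have "\<beta> f \<in> centre R"
      using f \<phi>(2) by (simp add: image_subset_iff) (metis (no_types))
    then have "\<beta> (x \<otimes>\<^bsub>P\<^esub> f \<otimes>\<^bsub>P\<^esub> inv\<^bsub>P\<^esub> x) = \<beta> f"
      using x f conj_central[OF \<beta>.H.is_group] by simp
    moreover have "\<alpha> (x \<otimes>\<^bsub>P\<^esub> f \<otimes>\<^bsub>P\<^esub> inv\<^bsub>P\<^esub> x) = \<alpha> f"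
      using x f A(2) conj_central[OF \<alpha>.H.is_group] by auto
    ultimately show ?thesis
      using x f by simp
  qed
  ultimately show ?thesis
    by (simp add: \<alpha>.G.normal_inv_iff)
qed

lemma hom_projection_FactGroup:
  assumes "\<And>i. i \<in> I \<Longrightarrow> group (G i)" "i \<in> I" "H \<lhd> G i"
  shows "group_hom (product_group I G) (G i Mod H) (\<lambda>f. H #>\<^bsub>G i\<^esub> f i)"
proof -
  interpret H: normal H "G i" by fact
  show ?thesis
    using assms H.factorgroup_is_group
    by (auto simp: group_hom_def group_hom_axioms_def hom_def carrier_FactGroup H.rcos_sum
        PiE_iff intro!: imageI)
qed

text \<open>
  A pulled back graph that contains \<open>(x, y)\<close> and \<open>(1, 1)\<close> and is a product of sets also contains
  \<open>(x, 1)\<close>. Then \<open>\<phi>\<close> is trivial on the coset of \<open>x\<close>, so \<open>x \<in> H\<close> by injectivity.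
\<close>
lemma NS_condition_if_normal_subgroups_are_products:
  fixes G :: "'i \<Rightarrow> ('a, 'b) monoid_scheme"
  assumes G: "\<And>i. i \<in> I \<Longrightarrow> group (G i)"
    and box: "\<And>K. K \<lhd> product_group I G \<Longrightarrow> \<exists>N. K = (\<Pi>\<^sub>E i\<in>I. N i)"
    and i: "i \<in> I" and j: "j \<in> I" and "i \<noteq> j"
  shows "NS_condition (G i) (G j)"
  unfolding NS_condition_def
proof (intro allI impI notI)
  fix H H'
  assume H: "H \<lhd> G i" and H': "H' \<lhd> G j"
  interpret H: normal H "G i" by fact
  interpret H': normal H' "G j" by fact
  let ?Q = "G i Mod H" and ?R = "G j Mod H'"
  have Q: "group ?Q" and R: "group ?R"
    by (rule H.factorgroup_is_group, rule H'.factorgroup_is_group)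
  assume "subgroup_in_common (centre_group ?Q) (centre_group ?R)"
  then obtain A B where A: "subgroup A ?Q" "A \<subseteq> centre ?Q" "A \<noteq> {\<one>\<^bsub>?Q\<^esub>}"
    and B: "B \<subseteq> centre ?R" and "?Q\<lparr>carrier := A\<rparr> \<cong> ?R\<lparr>carrier := B\<rparr>" "subgroup B ?R"
    unfolding subgroup_in_common_centre_group_iff[OF Q R] by blast
  then obtain \<phi> where \<phi>: "\<phi> \<in> iso (?Q\<lparr>carrier := A\<rparr>) (?R\<lparr>carrier := B\<rparr>)"
    by (auto simp: is_iso_def)
  then have \<phi>B: "\<phi> ` A = B" and inj: "inj_on \<phi> A"
    by (auto simp: iso_def bij_betw_def)
  have \<phi>_hom: "\<phi> \<in> hom (?Q\<lparr>carrier := A\<rparr>) ?R"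
    using \<phi> subgroup.subset[OF \<open>subgroup B ?R\<close>] by (auto simp: iso_def hom_def)
  interpret A: subgroup A ?Q by fact
  interpret \<phi>: group_hom "?Q\<lparr>carrier := A\<rparr>" ?R \<phi>
    using \<phi>_hom Q R A(1) by (simp add: group_hom_def group_hom_axioms_def group.subgroup_imp_group)
  define K where "K = {f \<in> carrier (product_group I G). H #>\<^bsub>G i\<^esub> f i \<in> A
    \<and> \<phi> (H #>\<^bsub>G i\<^esub> f i) = H' #>\<^bsub>G j\<^esub> f j}"
  have "K \<lhd> product_group I G"
    unfolding K_def using A(1,2) \<phi>_hom \<phi>B B
    by (intro normal_graph_of_central_hom[where Q = ?Q and R = ?R]
        hom_projection_FactGroup G i j H H') auto
  with box obtain N where N: "K = (\<Pi>\<^sub>E k\<in>I. N k)"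
    by blast
  have "H \<in> A"
    using A.one_closed by simp
  then obtain a where a: "a \<in> A" "a \<noteq> H"
    using A(3) by auto
  obtain x where x: "x \<in> carrier (G i)" "a = H #>\<^bsub>G i\<^esub> x"
    using a(1) A.subset by (auto simp: carrier_FactGroup)
  obtain y where y: "y \<in> carrier (G j)" "\<phi> a = H' #>\<^bsub>G j\<^esub> y"
    using a(1) \<phi>.hom_closed[of a] by (auto simp: carrier_FactGroup)
  have ones: "\<one>\<^bsub>G k\<^esub> \<in> carrier (G k)" if "k \<in> I" for k
    using G[OF that] by (simp add: group.is_monoid)
  define e where "e = (\<lambda>k\<in>I. \<one>\<^bsub>G k\<^esub>)"
  define f where "f = (\<lambda>k\<in>I. if k = i then x else if k = j then y else \<one>\<^bsub>G k\<^esub>)"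
  have \<phi>H: "\<phi> H = H'"
    using \<phi>.hom_one by simp
  have "e \<in> K"
    using i j ones \<open>H \<in> A\<close> \<phi>H
    by (auto simp: K_def e_def H.coset_join2 H'.coset_join2 H.subgroup_axioms H'.subgroup_axioms)
  have "f \<in> K"
    using i j ones x y a(1) \<open>i \<noteq> j\<close> by (auto simp: K_def f_def)
  \<comment> \<open>\<open>K\<close> being a product, a coordinate of \<open>f\<close> may be exchanged for that of another element of \<open>K\<close>.\<close>
  have "f(j := \<one>\<^bsub>G j\<^esub>) \<in> K"
    using \<open>e \<in> K\<close> \<open>f \<in> K\<close> j unfolding N by (fastforce simp: PiE_iff e_def extensional_def)
  then have "\<phi> a = H'"
    using i j x \<open>i \<noteq> j\<close>
    by (auto simp: K_def f_def H'.coset_join2 H'.subgroup_axioms)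
  then have "a = H"
    using inj_onD[OF inj, of a H] a(1) \<open>H \<in> A\<close> \<phi>H by simp
  with a(2) show False by contradiction
qed

section \<open>Normal subgroups of a finite product\<close>

definition single_factor ::
  "'i set \<Rightarrow> ('i \<Rightarrow> ('a, 'b) monoid_scheme) \<Rightarrow> 'i \<Rightarrow> 'a \<Rightarrow> 'i \<Rightarrow> 'a" where
  "single_factor I G i x = (\<lambda>k\<in>I. if k = i then x else \<one>\<^bsub>G k\<^esub>)"

locale normal_in_finite_product =
  fixes I :: "'i set" and G :: "'i \<Rightarrow> ('a, 'b) monoid_scheme" and K
  assumes finite_I: "finite I"
    and group_G: "\<And>i. i \<in> I \<Longrightarrow> group (G i)"
    and normal_K: "K \<lhd> product_group I G"
begin

abbreviation P where "P \<equiv> product_group I G"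

definition slice :: "'i \<Rightarrow> 'a set" where
  "slice i = {x \<in> carrier (G i). single_factor I G i x \<in> K}"

sublocale K: normal K P
  by (fact normal_K)

lemmas K_one = subgroup.one_closed[OF K.subgroup_axioms]
  and K_mult = subgroup.m_closed[OF K.subgroup_axioms]
  and K_inv = subgroup.m_inv_closed[OF K.subgroup_axioms]

lemma one_closed_G: "i \<in> I \<Longrightarrow> \<one>\<^bsub>G i\<^esub> \<in> carrier (G i)"
  by (simp add: group_G group.is_monoid)

lemma single_factor_closed:
  "i \<in> I \<Longrightarrow> x \<in> carrier (G i) \<Longrightarrow> single_factor I G i x \<in> carrier P"
  by (auto simp: single_factor_def one_closed_G)

lemma single_factor_mult:
  assumes "i \<in> I" "x \<in> carrier (G i)" "y \<in> carrier (G i)"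
  shows "single_factor I G i x \<otimes>\<^bsub>P\<^esub> single_factor I G i y = single_factor I G i (x \<otimes>\<^bsub>G i\<^esub> y)"
  by (auto simp: single_factor_def fun_eq_iff group_G group.is_monoid)

lemma single_factor_inv:
  assumes "i \<in> I" "x \<in> carrier (G i)"
  shows "inv\<^bsub>P\<^esub> single_factor I G i x = single_factor I G i (inv\<^bsub>G i\<^esub> x)"
  using single_factor_closed[OF assms] group_G
  by (auto simp: single_factor_def fun_eq_iff group.is_monoid monoid.inv_one)

lemma single_factor_one: "i \<in> I \<Longrightarrow> single_factor I G i \<one>\<^bsub>G i\<^esub> = \<one>\<^bsub>P\<^esub>"
  by (auto simp: single_factor_def fun_eq_iff)

lemma slice_normal:
  assumes i: "i \<in> I"
  shows "slice i \<lhd> G i"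
proof -
  interpret Gi: group "G i" by (rule group_G[OF i])
  have "subgroup (slice i) (G i)"
  proof (rule Gi.subgroupI)
    show "slice i \<subseteq> carrier (G i)"
      by (auto simp: slice_def)
    show "slice i \<noteq> {}"
      using K_one single_factor_one[OF i] Gi.one_closed
      unfolding slice_def by (metis (mono_tags, lifting) empty_iff mem_Collect_eq)
  next
    fix x assume "x \<in> slice i"
    then show "inv\<^bsub>G i\<^esub> x \<in> slice i"
      using K_inv[of "single_factor I G i x"] single_factor_inv[OF i, of x]
      unfolding slice_def by simp
  next
    fix x y assume "x \<in> slice i" "y \<in> slice i"
    then show "x \<otimes>\<^bsub>G i\<^esub> y \<in> slice i"
      using K_mult[of "single_factor I G i x" "single_factor I G i y"]
        single_factor_mult[OF i, of x y]
      unfolding slice_def by simp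
  qed
  moreover have "x \<otimes>\<^bsub>G i\<^esub> h \<otimes>\<^bsub>G i\<^esub> inv\<^bsub>G i\<^esub> x \<in> slice i"
    if x: "x \<in> carrier (G i)" and h: "h \<in> slice i" for x h
  proof -
    have hc: "h \<in> carrier (G i)" and hK: "single_factor I G i h \<in> K"
      using h by (auto simp: slice_def)
    have "single_factor I G i x \<otimes>\<^bsub>P\<^esub> single_factor I G i h \<otimes>\<^bsub>P\<^esub> inv\<^bsub>P\<^esub> single_factor I G i x \<in> K"
      using single_factor_closed[OF i x] hK by (rule K.inv_op_closed2)
    then show ?thesis
      unfolding single_factor_inv[OF i x] single_factor_mult[OF i x hc]
      using x hc i by (simp add: single_factor_mult slice_def del: mult_product_group)
  qed
  ultimately show ?thesis
    by (simp add: Gi.normal_inv_iff)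
qed

text \<open>
  This is where finiteness of \<open>I\<close> is essential: an element of the product of the slices is a finite
  product of tuples with a single non-trivial coordinate. In an infinite product of non-trivial
  groups the finitely supported elements form a proper normal subgroup whose slices are the whole
  factors.
\<close>
lemma PiE_slice_subset: "(\<Pi>\<^sub>E i\<in>I. slice i) \<subseteq> K"
proof
  fix f assume f: "f \<in> (\<Pi>\<^sub>E i\<in>I. slice i)"
  have fc: "f k \<in> carrier (G k)" if "k \<in> I" for k
    using f that by (auto simp: slice_def)
  have "(\<lambda>k\<in>I. if k \<in> J then f k else \<one>\<^bsub>G k\<^esub>) \<in> K" if "J \<subseteq> I" for J
    using finite_subset[OF that finite_I] that
  proof (induction J)
    case empty
    then show ?case using K_one by (simp add: restrict_def)
  next
    case (insert j J)
    then have "(\<lambda>k\<in>I. if k \<in> J then f k else \<one>\<^bsub>G k\<^esub>) \<otimes>\<^bsub>P\<^esub> single_factor I G j (f j) \<in> K"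
      by (intro K_mult insert.IH) (use insert.prems f in \<open>auto simp: slice_def\<close>)
    moreover have "(\<lambda>k\<in>I. if k \<in> J then f k else \<one>\<^bsub>G k\<^esub>) \<otimes>\<^bsub>P\<^esub> single_factor I G j (f j)
      = (\<lambda>k\<in>I. if k \<in> insert j J then f k else \<one>\<^bsub>G k\<^esub>)"
      using insert.hyps fc by (auto simp: single_factor_def fun_eq_iff group_G group.is_monoid)
    ultimately show ?case by (simp only:)
  qed
  from this[of I] have "restrict f I \<in> K"
    by (simp cong: restrict_cong)
  then show "f \<in> K"
    using f by (simp add: PiE_restrict)
qed

text \<open>
  The commutator of \<open>f\<close> with the tuple that has \<open>g\<close> in place \<open>i\<close> lies in \<open>K\<close> by normality, and all its
  coordinates except the \<open>i\<close>-th are trivial; so its \<open>i\<close>-th coordinate, the commutator of \<open>f i\<close> and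
  \<open>g\<close>, lies in the slice.
\<close>
lemma coset_of_coordinate_central:
  assumes i: "i \<in> I" and f: "f \<in> K"
  shows "slice i #>\<^bsub>G i\<^esub> f i \<in> centre (G i Mod slice i)"
proof (rule normal.rcos_in_centre_FactGroup[OF slice_normal[OF i]])
  have fP: "f \<in> carrier P"
    using f K.subset by blast
  then have fc: "f k \<in> carrier (G k)" if "k \<in> I" for k
    using that by auto
  then show "f i \<in> carrier (G i)"
    using i .
  fix g assume g: "g \<in> carrier (G i)"
  interpret Gi: group "G i" by (rule group_G[OF i])
  let ?e = "single_factor I G i g"
  have e: "?e \<in> carrier P"
    using single_factor_closed[OF i g] .
  \<comment> \<open>The bracketing exhibits the commutator as \<open>f\<close> times a conjugate of its inverse.\<close>
  have "f \<otimes>\<^bsub>P\<^esub> (?e \<otimes>\<^bsub>P\<^esub> inv\<^bsub>P\<^esub> f \<otimes>\<^bsub>P\<^esub> inv\<^bsub>P\<^esub> ?e) \<in> K"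
    using f e by (intro K_mult K.inv_op_closed2 K_inv)
  also have "f \<otimes>\<^bsub>P\<^esub> (?e \<otimes>\<^bsub>P\<^esub> inv\<^bsub>P\<^esub> f \<otimes>\<^bsub>P\<^esub> inv\<^bsub>P\<^esub> ?e)
      = single_factor I G i ((f i \<otimes>\<^bsub>G i\<^esub> g) \<otimes>\<^bsub>G i\<^esub> inv\<^bsub>G i\<^esub> (g \<otimes>\<^bsub>G i\<^esub> f i))"
    unfolding single_factor_inv[OF i g]
    using fP fc i g group_G
    by (auto simp: single_factor_def fun_eq_iff group.is_monoid Gi.inv_mult_group Gi.m_assoc group.r_inv)
  finally show "(f i \<otimes>\<^bsub>G i\<^esub> g) \<otimes>\<^bsub>G i\<^esub> inv\<^bsub>G i\<^esub> (g \<otimes>\<^bsub>G i\<^esub> f i) \<in> slice i"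
    using fc[OF i] g by (simp add: slice_def)
qed

definition slice_support :: "('i \<Rightarrow> 'a) \<Rightarrow> 'i set" where
  "slice_support f = {k \<in> I. f k \<notin> slice k}"

text \<open>
  If all coordinates but the \<open>i\<close>-th lie in their slices, then dividing \<open>f\<close> by an element of the
  product of the slices leaves only \<open>f i\<close>, and the quotient still lies in \<open>K\<close>.
\<close>
lemma slice_support_not_singleton:
  assumes f: "f \<in> K"
  shows "slice_support f \<noteq> {i}"
proof
  assume supp: "slice_support f = {i}"
  then have i: "i \<in> I" and fi: "f i \<notin> slice i"
    and fk: "\<And>k. k \<in> I \<Longrightarrow> k \<noteq> i \<Longrightarrow> f k \<in> slice k"
    by (auto simp: slice_support_def)
  have fP: "f \<in> carrier P"
    using f K.subset by blast
  then have fc: "f k \<in> carrier (G k)" if "k \<in> I" for k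
    using that by auto
  have ones: "\<one>\<^bsub>G k\<^esub> \<in> slice k" if "k \<in> I" for k
    using slice_normal[OF that] by (simp add: normal_imp_subgroup subgroup.one_closed)
  define r where "r = (\<lambda>k\<in>I. if k = i then \<one>\<^bsub>G i\<^esub> else f k)"
  have "r \<in> K"
    using PiE_slice_subset ones fk by (fastforce simp: r_def)
  then have "f \<otimes>\<^bsub>P\<^esub> inv\<^bsub>P\<^esub> r \<in> K"
    using f by (intro K_mult K_inv)
  moreover have "f \<otimes>\<^bsub>P\<^esub> inv\<^bsub>P\<^esub> r = single_factor I G i (f i)"
    using \<open>r \<in> K\<close> K.subset fc i group_G
    by (subst inv_product_group)
      (auto simp: r_def single_factor_def fun_eq_iff group.is_monoid group.r_inv monoid.inv_one)
  ultimately show False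
    using fi fc[OF i] by (simp add: slice_def)
qed

text \<open>
  An element of \<open>K\<close> of minimal non-empty slice support yields, at two places of that support,
  isomorphic non-trivial central subgroups of the quotients by the slices.
\<close>
lemma eq_PiE_slice_if_NS:
  assumes NS: "\<And>i j. i \<in> I \<Longrightarrow> j \<in> I \<Longrightarrow> i \<noteq> j \<Longrightarrow> NS_condition (G i) (G j)"
  shows "K = (\<Pi>\<^sub>E i\<in>I. slice i)"
proof (rule antisym[OF subsetI PiE_slice_subset], rule ccontr)
  fix f0 assume "f0 \<in> K" "f0 \<notin> (\<Pi>\<^sub>E i\<in>I. slice i)"
  then have "f0 \<in> K \<and> slice_support f0 \<noteq> {}"
    using K.subset by (auto simp: slice_support_def PiE_iff)
  then obtain f where f: "f \<in> K" "slice_support f \<noteq> {}"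
    and minimal: "\<And>g. g \<in> K \<Longrightarrow> slice_support g \<noteq> {} \<Longrightarrow> card (slice_support f) \<le> card (slice_support g)"
    using ex_has_least_nat[of "\<lambda>f. f \<in> K \<and> slice_support f \<noteq> {}" f0 "\<lambda>f. card (slice_support f)"] by blast
  obtain i j where ij: "i \<in> slice_support f" "j \<in> slice_support f" "i \<noteq> j"
    using f slice_support_not_singleton by blast
  then have i: "i \<in> I" and j: "j \<in> I"
    by (auto simp: slice_support_def)
  define L where "L = K \<inter> (\<Pi>\<^sub>E k\<in>I. if k \<in> slice_support f then carrier (G k) else slice k)"
  have L_sub: "subgroup L P"
    unfolding L_def
    by (intro K.subgroups_Inter_pair K.subgroup_axioms)
      (auto simp: PiE_subgroup_product_group group_G group.subgroup_self slice_normal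
        normal_imp_subgroup)
  have L_P: "L \<subseteq> carrier P"
    using subgroup.subset[OF L_sub] .
  have "f \<in> L"
    using f(1) subsetD[OF K.subset f(1)] by (auto simp: L_def slice_support_def PiE_iff)
  have all_or_nothing: "slice_support g = slice_support f" if "g \<in> L" "slice_support g \<noteq> {}" for g
  proof -
    have "slice_support g \<subseteq> slice_support f"
      using that(1) by (fastforce simp: L_def slice_support_def split: if_splits)
    moreover have "finite (slice_support f)"
      using finite_I by (simp add: slice_support_def)
    ultimately show ?thesis
      using card_seteq[of "slice_support f" "slice_support g"] minimal[of g] that by (auto simp: L_def)
  qed
  let ?L = "P\<lparr>carrier := L\<rparr>" and ?Q = "\<lambda>k. G k Mod slice k"
  let ?\<pi> = "\<lambda>k f. slice k #>\<^bsub>G k\<^esub> f k"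
  have hom: "group_hom ?L (?Q k) (?\<pi> k)" if "k \<in> I" for k
  proof -
    have "group_hom P (?Q k) (?\<pi> k)"
      using group_G that slice_normal[OF that] by (rule hom_projection_FactGroup)
    then show ?thesis
      using L_sub by (rule group_hom.group_hom_on_subgroup)
  qed
  have \<pi>_one: "?\<pi> k g = slice k \<longleftrightarrow> k \<notin> slice_support g" if "g \<in> L" "k \<in> I" for g k
    using normal.rcos_eq_iff_mem[OF slice_normal[OF that(2)], of "g k"] that L_P
    by (auto simp: slice_support_def)
  \<comment> \<open>The kernel does not depend on the place \<open>k\<close>; this is what minimality was for.\<close>
  have ker: "kernel ?L (?Q k) (?\<pi> k) = {g \<in> L. slice_support g = {}}" if "k \<in> slice_support f" for k
    using that \<pi>_one all_or_nothing by (fastforce simp: kernel_def slice_support_def)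
  have image: "subgroup (?\<pi> k ` L) (?Q k)" "?\<pi> k ` L \<subseteq> centre (?Q k)" "?\<pi> k ` L \<noteq> {\<one>\<^bsub>?Q k\<^esub>}"
    if "k \<in> slice_support f" for k
  proof -
    have k: "k \<in> I" using that by (simp add: slice_support_def)
    show "subgroup (?\<pi> k ` L) (?Q k)"
      using group_hom.img_is_subgroup[OF hom[OF k]] by simp
    show "?\<pi> k ` L \<subseteq> centre (?Q k)"
      using coset_of_coordinate_central[OF k] by (auto simp: L_def)
    show "?\<pi> k ` L \<noteq> {\<one>\<^bsub>?Q k\<^esub>}"
      using \<pi>_one[OF \<open>f \<in> L\<close> k] that \<open>f \<in> L\<close> by auto
  qed
  have "(?Q i)\<lparr>carrier := ?\<pi> i ` L\<rparr> \<cong> (?Q j)\<lparr>carrier := ?\<pi> j ` L\<rparr>"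
    using iso_images_if_same_kernel[OF hom[OF i] hom[OF j]] ker ij by simp
  then have "subgroup_in_common (centre_group (?Q i)) (centre_group (?Q j))"
    using image[OF ij(1)] image[OF ij(2)] normal.factorgroup_is_group[OF slice_normal] i j
    by (subst subgroup_in_common_centre_group_iff) blast+
  then show False
    using NS[OF i j ij(3)] slice_normal i j by (auto simp: NS_condition_def)
qed

end

theorem corollary3p3:
  fixes G :: "nat \<Rightarrow> ('a, 'b) monoid_scheme" and n :: nat
  assumes "\<And>i. i \<in> {1..n} \<Longrightarrow> group (G i)"
  shows "(\<forall>K. K \<lhd> product_group {1..n} G \<longrightarrow>
            (\<exists>N. (\<forall>i \<in> {1..n}. N i \<lhd> G i) \<and> K = (\<Pi>\<^sub>E i\<in>{1..n}. N i)))
         \<longleftrightarrow> (\<forall>i \<in> {1..n}. \<forall>j \<in> {1..n}. i \<noteq> j \<longrightarrow> NS_condition (G i) (G j))"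
    (is "?products \<longleftrightarrow> ?NS")
proof
  assume products: ?products
  show ?NS
  proof (intro ballI impI)
    fix i j assume ij: "i \<in> {1..n}" "j \<in> {1..n}" "i \<noteq> j"
    have "\<exists>N. K = (\<Pi>\<^sub>E i\<in>{1..n}. N i)" if "K \<lhd> product_group {1..n} G" for K
      using products[rule_format, OF that] by (elim exE conjE) (rule exI)
    from NS_condition_if_normal_subgroups_are_products[OF assms this ij]
    show "NS_condition (G i) (G j)" .
  qed
next
  assume NS: ?NS
  show ?products
  proof (intro allI impI)
    fix K assume K: "K \<lhd> product_group {1..n} G"
    interpret normal_in_finite_product "{1..n}" G K
      using finite_atLeastAtMost assms K by (rule normal_in_finite_product.intro)
    have "K = (\<Pi>\<^sub>E i\<in>{1..n}. slice i)"
      by (rule eq_PiE_slice_if_NS) (rule NS[rule_format])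
    then show "\<exists>N. (\<forall>i \<in> {1..n}. N i \<lhd> G i) \<and> K = (\<Pi>\<^sub>E i\<in>{1..n}. N i)"
      using slice_normal by (intro exI[of _ slice] conjI ballI)
  qed
qed

end
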